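(* For every $n\ge1$, each of the $S$-sets $SF$, $S\widehat{F}$, $\widehat{S}F$ and $\widehat{SF}$ is invariant under the action of $\Delta_n$: if $T$ is any one of these four sets, $X_C\in T$ and $\delta_r\in\Delta_n$, then $(\delta_rX)_C\in T$.
   Context: $\mathbb{Z}_2=\{+,-\}=\{1,-1\}$ and $\mathbb{Z}_2^n$ is the group of $\pm1$ sequences $X=(x_0,\dots,x_{n-1})$, indices modulo $n$. $C(x_0,\dots,x_{n-1})=(x_1,\dots,x_{n-1},x_0)$ and $X_C=\{C^i(X):0\le i<n\}$; $\mathbb{Z}_{2C}^n$ is the set of all such orbits. $RX=(x_{n-1},\dots,x_1,x_0)$. $X_C$ is symmetric if there exists $Y\in X_C$ with $RY=Y$, and nonsymmetric otherwise. $X_C$ is free if $|X_C|=n$ and non-free if $|X_C|<n$. $SF$ is the set of symmetric free orbits, $S\widehat{F}$ the set of symmetric non-free orbits, $\widehat{S}F$ the set of nonsymmetric free orbits, and $\widehat{SF}$ the set of nonsymmetric non-free orbits. $\Delta_n=\{\delta_r:\gcd(r,n)=1\}$, where $(\delta_rX)_i=x_{ri\bmod n}$; it acts on orbits by $\delta_r(X_C)=(\delta_rX)_C$. *)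

theory Defs
  imports Main
begin

text \<open>
  A \<open>\<plusminus>1\<close> sequence \<open>(x\<^sub>0, \<dots>, x\<^bsub>n-1\<^esub>)\<close> is a list of integers of length \<open>n\<close>; the cyclic shift \<open>C\<close> is
  \<^const>\<open>rotate1\<close> and the reversal \<open>R\<close> is \<^const>\<open>rev\<close>.
\<close>

definition pm_seqs :: "nat \<Rightarrow> int list set" where
  "pm_seqs n = {X. length X = n \<and> set X \<subseteq> {1, -1}}"

definition orbit :: "nat \<Rightarrow> int list \<Rightarrow> int list set" where
  "orbit n X = {(rotate1 ^^ i) X | i. i < n}"

definition orbits :: "nat \<Rightarrow> int list set set" where
  "orbits n = orbit n ` pm_seqs n"

definition symmetric :: "int list set \<Rightarrow> bool" where
  "symmetric A \<longleftrightarrow> (\<exists>Y\<in>A. rev Y = Y)"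

definition SF :: "nat \<Rightarrow> int list set set" where
  "SF n = {A \<in> orbits n. symmetric A \<and> card A = n}"

definition SnF :: "nat \<Rightarrow> int list set set" where
  "SnF n = {A \<in> orbits n. symmetric A \<and> card A < n}"

definition nSF :: "nat \<Rightarrow> int list set set" where
  "nSF n = {A \<in> orbits n. \<not> symmetric A \<and> card A = n}"

definition nSnF :: "nat \<Rightarrow> int list set set" where
  "nSnF n = {A \<in> orbits n. \<not> symmetric A \<and> card A < n}"

text \<open>
  The index \<open>r\<close> ranges over all integers; \<open>delta n r\<close> depends only on \<open>r\<close> modulo \<open>n\<close>.
\<close>

definition delta :: "nat \<Rightarrow> int \<Rightarrow> int list \<Rightarrow> int list" where
  "delta n r X = map (\<lambda>i. X ! nat ((r * int i) mod int n)) [0..<n]"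

definition Delta :: "nat \<Rightarrow> (int list \<Rightarrow> int list) set" where
  "Delta n = {delta n r | r. gcd r (int n) = 1}"

end

theory Submission imports Defs "HOL-Number_Theory.Cong" begin

text \<open>
  Read a sequence as an \<open>n\<close>-periodic function on the integers. Then \<open>\<delta>\<^sub>r\<close> is a bijection with inverse
  \<open>\<delta>\<^sub>s\<close>, \<open>r s \<equiv> 1\<close>, and it intertwines the shift by \<open>r k\<close> with the shift by \<open>k\<close>; so it maps an orbit
  bijectively onto an orbit, which settles freeness. If \<open>Y\<close> is palindromic, i.e. \<open>Y(-1 - z) = Y(z)\<close>,
  then \<open>\<delta>\<^sub>r Y\<close> is invariant under \<open>z \<mapsto> -s - z\<close>. The inverse \<open>s\<close> can be chosen odd, and then the shift of
  \<open>\<delta>\<^sub>r Y\<close> by \<open>(1 - s) / 2\<close> is again palindromic. Applying the same to \<open>\<delta>\<^sub>s\<close> gives the converse.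
\<close>

text \<open>The \<open>n\<close>-periodic extension of a list to all integers: rotation, reversal
  and \<open>delta\<close> become the affine substitutions z + k, -1 - z and r * z. Nonemptiness is
  assumed where it matters, since reducing modulo 0 leaves \<open>z\<close> unchanged.\<close>

definition cnth :: "'a list \<Rightarrow> int \<Rightarrow> 'a" where
  "cnth X z = X ! nat (z mod int (length X))"

lemma cnth_cong: "[a = b] (mod int (length X)) \<Longrightarrow> cnth X a = cnth X b"
  by (simp add: cnth_def cong_def)

lemma cnth_of_nat: "i < length X \<Longrightarrow> cnth X (int i) = X ! i"
  by (simp add: cnth_def)

lemma cnth_ext:
  assumes "length X = length Y" "\<And>z. cnth X z = cnth Y z"
  shows "X = Y"
  using assms by (metis cnth_of_nat nth_equalityI)

lemma cnth_rotate:
  assumes "X \<noteq> []"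
  shows "cnth (rotate k X) z = cnth X (z + int k)"
proof -
  have pos: "0 < length X" using assms by simp
  then have "nat (z mod int (length X)) < length X"
    by (simp add: nat_less_iff)
  then have "cnth (rotate k X) z = X ! ((k + nat (z mod int (length X))) mod length X)"
    by (simp add: cnth_def nth_rotate)
  also have "\<dots> = cnth X (int (k + nat (z mod int (length X))))"
    by (simp only: cnth_def zmod_int[symmetric] nat_int)
  also have "\<dots> = cnth X (z + int k)"
    using pos by (intro cnth_cong) (simp add: cong_def mod_simps add.commute)
  finally show ?thesis .
qed

text \<open>Reversal sends position i to n - 1 - i, which is congruent to -1 - i modulo the length
  n.\<close>

lemma cnth_rev:
  assumes "X \<noteq> []"
  shows "cnth (rev X) z = cnth X (-1 - z)"
proof -
  define i where "i = nat (z mod int (length X))"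
  have i: "i < length X" "int i = z mod int (length X)"
    using assms by (simp_all add: i_def nat_less_iff)
  have "cnth (rev X) z = X ! (length X - Suc i)"
    using i(1) by (simp add: cnth_def rev_nth flip: i_def)
  also have "\<dots> = cnth X (int (length X - Suc i))"
    using i(1) by (intro cnth_of_nat[symmetric]) simp
  also have "\<dots> = cnth X (-1 - z)"
  proof (intro cnth_cong)
    have "int (length X - Suc i) = int (length X) + (-1 - z mod int (length X))"
      using i by (simp add: of_nat_diff)
    then show "[int (length X - Suc i) = -1 - z] (mod int (length X))"
      by (simp add: cong_def mod_simps)
  qed
  finally show ?thesis .
qed

section \<open>Multiplication of indices by \<open>r\<close>\<close>

lemma length_delta [simp]: "length (delta n r X) = n"
  by (simp add: delta_def)

lemma cnth_delta:
  assumes "length X = n" "n > 0"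
  shows "cnth (delta n r X) z = cnth X (r * z)"
proof -
  have "nat (z mod int n) < n" using assms by (simp add: nat_less_iff)
  then have "cnth (delta n r X) z = cnth X (r * (z mod int n))"
    using assms by (simp add: cnth_def delta_def)
  also have "\<dots> = cnth X (r * z)"
    using assms by (intro cnth_cong) (simp add: cong_def mod_simps)
  finally show ?thesis .
qed

lemma delta_pm_seqs:
  assumes "X \<in> pm_seqs n" "n > 0"
  shows "delta n r X \<in> pm_seqs n"
proof -
  have "X ! nat (z mod int n) \<in> set X" for z
    using assms by (intro nth_mem) (simp add: pm_seqs_def nat_less_iff)
  then show ?thesis using assms by (auto simp: pm_seqs_def delta_def)
qed

lemma delta_delta:
  assumes "length X = n" "n > 0" "[r * s = 1] (mod int n)"
  shows "delta n s (delta n r X) = X"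
proof (rule cnth_ext)
  fix z
  have "[r * (s * z) = 1 * z] (mod int n)"
    using cong_mult[OF assms(3) cong_refl[of z]] by (simp add: mult.assoc)
  then show "cnth (delta n s (delta n r X)) z = cnth X z"
    using assms by (auto simp: cnth_delta intro!: cnth_cong)
qed (use assms in simp)

section \<open>Images and sizes of orbits\<close>

lemma rotate_in_orbit:
  assumes "length X = n" "n > 0"
  shows "rotate k X \<in> orbit n X"
proof -
  have "rotate k X = (rotate1 ^^ (k mod n)) X"
    using assms rotate_conv_mod[of k X] by (simp add: rotate_def)
  then show ?thesis using assms by (auto simp: orbit_def)
qed

lemma orbit_conv_rotate:
  assumes "length X = n" "n > 0"
  shows "orbit n X = range (\<lambda>k. rotate k X)"
  using rotate_in_orbit[OF assms] by (auto simp: orbit_def rotate_def)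

text \<open>At \<open>z\<close> the two sides read \<open>X\<close> at
  \<open>r * (z + int k)\<close> and at \<open>r * z + int m\<close>. A congruence links
  \<open>m\<close> and \<open>k\<close> because \<open>r\<close> may be negative while rotation
  amounts are natural numbers.\<close>

lemma rotate_delta:
  assumes "length X = n" "n > 0" "[int m = r * int k] (mod int n)"
  shows "rotate k (delta n r X) = delta n r (rotate m X)"
proof (rule cnth_ext)
  fix z
  have "[r * (z + int k) = r * z + int m] (mod int n)"
    using cong_add[OF cong_refl[of "r * z"] assms(3)] by (simp add: distrib_left cong_sym)
  moreover have "X \<noteq> []" "delta n r X \<noteq> []"
    using assms by (auto simp flip: length_greater_0_conv)
  ultimately show "cnth (rotate k (delta n r X)) z = cnth (delta n r (rotate m X)) z"
    using assms by (auto simp: cnth_delta cnth_rotate intro!: cnth_cong)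
qed simp

lemma cong_nat_representative:
  assumes "n > 0"
  obtains k where "[int k = z] (mod int n)"
proof
  show "[int (nat (z mod int n)) = z] (mod int n)" using assms by (simp add: cong_def)
qed

lemma delta_image_orbit:
  assumes X: "length X = n" "n > 0" and rs: "[r * s = 1] (mod int n)"
  shows "delta n r ` orbit n X = orbit n (delta n r X)"
proof (intro equalityI subsetI)
  fix Y assume "Y \<in> delta n r ` orbit n X"
  then obtain m where Y: "Y = delta n r (rotate m X)"
    using X by (auto simp: orbit_conv_rotate)
  \<comment> \<open>Solves m = r * k for the rotation amount after \<open>delta n r\<close>; this is
    where invertibility of \<open>r\<close> enters.\<close>
  obtain k where k: "[int k = s * int m] (mod int n)"
    using cong_nat_representative X by blast
  have "[r * int k = r * (s * int m)] (mod int n)"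
    using k by (rule cong_scalar_left)
  moreover have "[r * (s * int m) = int m] (mod int n)"
    using cong_scalar_right[OF rs, of "int m"] by (simp add: mult.assoc)
  ultimately have "[int m = r * int k] (mod int n)"
    by (meson cong_sym cong_trans)
  then have "Y = rotate k (delta n r X)" using X Y by (simp add: rotate_delta)
  then show "Y \<in> orbit n (delta n r X)" using X by (simp add: rotate_in_orbit)
next
  fix Y assume "Y \<in> orbit n (delta n r X)"
  then obtain k where Y: "Y = rotate k (delta n r X)"
    using X by (auto simp: orbit_conv_rotate)
  obtain m where "[int m = r * int k] (mod int n)"
    using cong_nat_representative X by blast
  then have "Y = delta n r (rotate m X)" using X Y by (simp add: rotate_delta)
  then show "Y \<in> delta n r ` orbit n X" using X by (simp add: rotate_in_orbit)
qed

lemma card_orbit_delta: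
  assumes X: "length X = n" "n > 0" and rs: "[r * s = 1] (mod int n)"
  shows "card (orbit n (delta n r X)) = card (orbit n X)"
proof -
  have "inj_on (delta n r) (orbit n X)"
  proof (rule inj_on_inverseI)
    fix Y assume "Y \<in> orbit n X"
    then have "length Y = n" using X by (auto simp: orbit_conv_rotate)
    then show "delta n s (delta n r Y) = Y" using X rs by (simp add: delta_delta)
  qed
  then show ?thesis using delta_image_orbit[OF assms] card_image by metis
qed

section \<open>Symmetry of orbits\<close>

text \<open>An even inverse forces \<open>n\<close> to be odd, since otherwise \<open>r * s\<close>
  would be odd; adding \<open>n\<close> then corrects the parity. Oddness makes (1 - s) / 2 an
  integer shift.\<close>

lemma odd_inverse_mod:
  fixes r :: int
  assumes "coprime r (int n)"
  obtains s where "[r * s = 1] (mod int n)" "odd s"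
proof -
  obtain s where s: "[r * s = 1] (mod int n)"
    using cong_solve_coprime_int[OF assms] by blast
  show ?thesis
  proof (cases "odd s")
    case True
    then show ?thesis using s that by blast
  next
    case False
    have "odd n"
    proof
      assume "even n"
      then have "[r * s = 1] (mod 2)"
        using s cong_dvd_modulus[of "r * s" 1 "int n" 2] by simp
      then show False using False by (simp add: cong_def)
    qed
    moreover have "[r * (s + int n) = 1] (mod int n)"
      using s by (simp add: cong_def distrib_left)
    ultimately show ?thesis using that[of "s + int n"] False by simp
  qed
qed

lemma symmetric_orbit_delta:
  assumes X: "length X = n" "n > 0" and r: "coprime r (int n)"
    and sym: "symmetric (orbit n X)"
  shows "symmetric (orbit n (delta n r X))"
proof -
  obtain s where s: "[r * s = 1] (mod int n)" "odd s"
    using odd_inverse_mod[OF r] by blast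
  obtain h where h: "1 - s = 2 * h"
    using s(2) dvd_def[of 2 "1 - s"] by auto
  obtain Y where Y: "Y \<in> orbit n X" "rev Y = Y"
    using sym by (auto simp: symmetric_def)
  have lY: "length Y = n" "Y \<noteq> []"
    using X Y(1) by (auto simp: orbit_conv_rotate)
  have palin: "cnth Y (-1 - z) = cnth Y z" for z
    using cnth_rev[OF lY(2)] Y(2) by metis
  have "delta n r Y \<in> orbit n (delta n r X)"
    using Y(1) delta_image_orbit[OF X s(1)] by blast
  \<comment> \<open>Makes \<open>W\<close> below, a rotation of \<open>delta n r Y\<close>, also a
    rotation of \<open>delta n r X\<close>.\<close>
  then obtain j where j: "delta n r Y = rotate j (delta n r X)"
    using X by (auto simp: orbit_conv_rotate)
  obtain k where k: "[int k = h] (mod int n)"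
    using cong_nat_representative X by blast
  \<comment> \<open>Shifting by \<open>h\<close> turns the reflection -s - z into -s - 2 * h - z,
    which is -1 - z by the choice of \<open>h\<close>.\<close>
  define W where "W = rotate k (delta n r Y)"
  have neD: "delta n r Y \<noteq> []"
    using X by (auto simp flip: length_greater_0_conv)
  have neW: "W \<noteq> []" using neD by (simp add: W_def)
  have lW: "length W = n" by (simp add: W_def)
  have W: "cnth W z = cnth Y (r * (z + h))" for z
  proof -
    have "[r * (z + int k) = r * (z + h)] (mod int n)"
      using k by (intro cong_scalar_left cong_add cong_refl)
    then show ?thesis
      using X lY neD by (auto simp: W_def cnth_rotate cnth_delta intro!: cnth_cong)
  qed
  have "rev W = W"
  proof (rule cnth_ext)
    fix z
    have "cnth (rev W) z = cnth Y (r * (-1 - z + h))"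
      using neW by (simp add: cnth_rev W)
    also have "\<dots> = cnth Y (-1 - r * (-1 - z + h))"
      by (simp add: palin)
    also have "\<dots> = cnth Y (r * (z + h))"
    proof (intro cnth_cong)
      have s_eq: "s = 1 - 2 * h" using h by simp
      \<comment> \<open>An exact integer identity that isolates \<open>r * s - 1\<close>, the only
        term to be removed modulo \<open>n\<close>.\<close>
      have "-1 - r * (-1 - z + h) = (r * s - 1) + r * (z + h)"
        unfolding s_eq by (simp add: algebra_simps)
      moreover have "[(r * s - 1) + r * (z + h) = 0 + r * (z + h)] (mod int n)"
        using s(1) by (intro cong_add cong_refl) (simp add: cong_diff_iff_cong_0)
      ultimately show "[-1 - r * (-1 - z + h) = r * (z + h)] (mod int (length Y))"
        by (simp only: lY(1) add_0_left)
    qed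
    finally show "cnth (rev W) z = cnth W z" by (simp add: W)
  qed simp
  moreover have "W \<in> orbit n (delta n r X)"
    using X by (simp add: W_def j rotate_rotate rotate_in_orbit)
  ultimately show ?thesis by (auto simp: symmetric_def)
qed

lemma symmetric_orbit_delta_iff:
  assumes X: "length X = n" "n > 0" and r: "coprime r (int n)"
  shows "symmetric (orbit n (delta n r X)) \<longleftrightarrow> symmetric (orbit n X)"
proof
  obtain s where s: "[r * s = 1] (mod int n)"
    using odd_inverse_mod[OF r] by blast
  \<comment> \<open>The congruence is symmetric in \<open>r\<close> and \<open>s\<close>, so the
    forward direction also applies to \<open>delta n s\<close>, which undoes
    \<open>delta n r\<close>.\<close>
  then have "coprime s (int n)"
    by (metis coprime_iff_invertible_int mult.commute)
  moreover assume "symmetric (orbit n (delta n r X))"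
  ultimately have "symmetric (orbit n (delta n s (delta n r X)))"
    using X symmetric_orbit_delta[of "delta n r X" n s] by simp
  then show "symmetric (orbit n X)" using X s by (simp add: delta_delta)
qed (use assms symmetric_orbit_delta in blast)

theorem corollary8:
  fixes n :: nat and T :: "int list set set" and X :: "int list"
    and d :: "int list \<Rightarrow> int list"
  assumes "n \<ge> 1"
    and "T \<in> {SF n, SnF n, nSF n, nSnF n}"
    and "X \<in> pm_seqs n"
    and "orbit n X \<in> T"
    and "d \<in> Delta n"
  shows "orbit n (d X) \<in> T"
proof -
  obtain r where d: "d = delta n r" and r: "coprime r (int n)"
    using assms(5) by (auto simp: Delta_def coprime_iff_gcd_eq_1)
  have X: "length X = n" "n > 0" using assms(1,3) by (auto simp: pm_seqs_def)
  obtain s where "[r * s = 1] (mod int n)"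
    using odd_inverse_mod[OF r] by blast
  then have "card (orbit n (d X)) = card (orbit n X)"
    using X by (simp add: d card_orbit_delta)
  moreover have "symmetric (orbit n (d X)) \<longleftrightarrow> symmetric (orbit n X)"
    using X r by (simp add: d symmetric_orbit_delta_iff)
  moreover have "orbit n (d X) \<in> orbits n"
    using X assms(3) by (simp add: d orbits_def delta_pm_seqs)
  \<comment> \<open>Each choice of \<open>T\<close> is cut out of \<open>orbits n\<close> by
    symmetry and cardinality alone, and both are preserved.\<close>
  ultimately show ?thesis
    using assms(2,4) by (auto simp: SF_def SnF_def nSF_def nSnF_def)
qed

end
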